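(* Let $n\ge2$, $T=[a,b]\subset\mathbb{R}$, and consider the non-homogenous linear ODE of order $n$ $$a_0(t)y^{(n)}+a_1(t)y^{(n-1)}+\dots+a_{n-1}(t)y'+a_n(t)y=b(t),$$ where $b(t)$ and $a_i(t)$, $i=0,\dots,n$, are given differentiable (smooth) real functions with $a_0(t)\ne0$ for all $t\in[a,b]$. With $x^1=y,\ x^2=y',\dots,x^n=y^{(n-1)}$ it is equivalent to the first order system $\frac{dx^i}{dt}=X_{(1)}^{(i)}(t,x)$, where $X_{(1)}^{(i)}(t,x)=x^{i+1}$ for $1\le i\le n-1$ and $$X_{(1)}^{(n)}(t,x)=f(t,x)=\frac{b(t)}{a_0(t)}-\frac{a_n(t)}{a_0(t)}x^1-\frac{a_{n-1}(t)}{a_0(t)}x^2-\dots-\frac{a_1(t)}{a_0(t)}x^n .$$ The geometrical objects on $J^1(T,\mathbb{R}^n)$ produced by this ODE (with respect to the pair of Euclidean metrics $\Delta=(1,\delta_{ij})$) are as follows. (i) The canonical non-linear connection is $\tilde\Gamma=\big(0,\tilde N_{(1)j}^{(i)}\big)$, where $\tilde N_{(1)j}^{(i)}$ ($i$ = row, $j$ = column) are the entries of the skew-symmetric matrix $$\tilde N_{(1)}=-\frac12\begin{pmatrix} 0&1&0&\cdots&0&0&\frac{a_n}{a_0}\\ -1&0&1&\cdots&0&0&\frac{a_{n-1}}{a_0}\\ 0&-1&0&\cdots&0&0&\frac{a_{n-2}}{a_0}\\ \vdots&\vdots&\vdots&\ddots&\vdots&\vdots&\vdots\\ 0&0&0&\cdots&0&1&\frac{a_3}{a_0}\\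 0&0&0&\cdots&-1&0&1+\frac{a_2}{a_0}\\ -\frac{a_n}{a_0}&-\frac{a_{n-1}}{a_0}&-\frac{a_{n-2}}{a_0}&\cdots&-\frac{a_3}{a_0}&-1-\frac{a_2}{a_0}&0 \end{pmatrix}.$$ (That is, the matrix $B$ with $\tilde N_{(1)}=-\frac12B$ is skew-symmetric, and above the diagonal $B_{i,i+1}=1$ and $B_{i,n}=\frac{a_{n-i+1}}{a_0}$ for $1\le i\le n-2$, $B_{n-1,n}=1+\frac{a_2}{a_0}$, and all other entries are zero.) (ii) All adapted components of the canonical generalized Cartan connection $C\tilde\Gamma$ vanish. (iii) All adapted components of the torsion d-tensor of $C\tilde\Gamma$ are zero, except the temporal components $$\tilde R_{(1)1n}^{(i)}=-\tilde R_{(1)1i}^{(n)}=\frac{a_{n-i+1}'a_0-a_{n-i+1}a_0'}{2a_0^2},\qquad i=1,\dots,n-1,$$ where $'$ denotes the derivative of the functions $a_k(t)$. (iv) All adapted components of the curvature d-tensor of $C\tilde\Gamma$ vanish. (v) The geometric electromagnetic distinguished 2-form is $\tilde F=\tilde F_{(i)j}^{(1)}\,\delta x_1^i\wedge dx^j$, where $\delta x_1^i=dx_1^i+\tilde N_{(1)k}^{(i)}dx^k$ for $i=1,\dots,n$, and $\tilde F^{(1)}=\big(\tilde F_{(i)j}^{(1)}\big)_{i,j=1,\dots,n}=-\tilde N_{(1)}$. (vi) The jet geometric Yang-Mills electromagnetic energy is $$EYM^{\text{NHLSODE}}(t)=\frac14\Big[n-1+2\frac{a_2}{a_0}+\sum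_{j=2}^n\frac{a_j^2}{a_0^2}\Big].$$
   Context: Setting. $T=[a,b]\subset\mathbb{R}$ is a compact interval; $J^1(T,\mathbb{R}^n)\to T\times\mathbb{R}^n$, $n\ge2$, is the first order jet bundle with coordinates $(t,x^i,x_1^i)$, which transform by $\widetilde t=\widetilde t(t)$, $\widetilde x^i=\widetilde x^i(x^j)$, $\widetilde x_1^i=\frac{\partial\widetilde x^i}{\partial x^j}\frac{dt}{d\widetilde t}x_1^j$. Repeated indices are summed. All given functions are smooth. Everything is expressed in a fixed convenient chart, in which the metrics are the Euclidean ones, and $X=(X_{(1)}^{(i)})$ is assumed to behave as a d-tensor. Geometrical objects produced by a first order ODE system. Let $X=(X_{(1)}^{(i)}(t,x))$ be a d-tensor field giving the system $x_1^i=X_{(1)}^{(i)}(t,x(t))$, $x_1^i=dx^i/dt$, and let $\mathcal P=(h_{11}(t),\varphi_{ij}(x))$ be a pair of Riemannian metrics on $T$ and $\mathbb{R}^n$ with Christoffel symbols $H_{11}^1(t)$, $\gamma_{jk}^i(x)$; $h^{11}=1/h_{11}$; $r^l_{ijk}$ is the curvature tensor of $\varphi$. Put $X_{(1)||j}^{(i)}=\frac{\partial X_{(1)}^{(i)}}{\partial x^j}+X_{(1)}^{(m)}\gamma_{mj}^i$, $\;X_{(1)||j//1}^{(i)}=\frac{\partial X_{(1)||j}^{(i)}}{\partial t}-X_{(1)||j}^{(i)}H_{11}^1$, $\;X_{(1)||j||k}^{(i)}=\frac{\partial X_{(1)||j}^{(i)}}{\partial x^k}+X_{(1)||j}^{(m)}\gamma_{mk}^i-X_{(1)||m}^{(i)}\gamma_{jk}^m$.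 The objects produced by the system and $\mathcal P$ (arising from the least squares Lagrangian $h^{11}\varphi_{ij}[x_1^i-X_{(1)}^{(i)}][x_1^j-X_{(1)}^{(j)}]$) are given by the following formulas, which are to be taken as their definitions: - Canonical non-linear connection: $(M_{(1)1}^{(i)},N_{(1)j}^{(i)})$ with $M_{(1)1}^{(i)}=-H_{11}^1x_1^i$ and $N_{(1)j}^{(i)}=\gamma_{jk}^ix_1^k-\frac12\big[X_{(1)||j}^{(i)}-\varphi^{ir}X_{(1)||r}^{(s)}\varphi_{sj}\big]$. - Canonical generalized Cartan connection: adapted components $(H_{11}^1,0,\gamma_{jk}^i,0)$. - Torsion d-tensor: its effective (i.e. possibly nonzero; all others are identically zero) adapted components are $R_{(1)1j}^{(i)}=\frac12\big[X_{(1)||j//1}^{(i)}-\varphi^{ir}X_{(1)||r//1}^{(s)}\varphi_{sj}\big]$ (temporal) and $R_{(1)jk}^{(i)}=r_{jkm}^ix_1^m-\frac12\big[X_{(1)||j||k}^{(i)}-\varphi^{ir}X_{(1)||r||k}^{(s)}\varphi_{sj}\big]$ (spatial; here $j,k$ range over $1,\dots,n$, and the "1" in $R_{(1)1j}^{(i)}$ is the time index, so temporal and spatial components are distinct objects despite overlapping notation). - Curvature d-tensor: its only effective adapted components are $R_{ijk}^l=r_{ijk}^l$. - Electromagnetic distinguished 2-form: $F=F_{(i)j}^{(1)}\delta x_1^i\wedge dx^j$, $\;\delta x_1^i=dx_1^i+M_{(1)1}^{(i)}dt+N_{(1)k}^{(i)}dx^k$, $\;F_{(i)j}^{(1)}=\frac{h^{11}}2\big[\varphi_{im}X_{(1)||j}^{(m)}-\varphi_{jm}X_{(1)||i}^{(m)}\big]$.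 - Jet Yang-Mills energy: $EYM=\sum_{i=1}^{n-1}\sum_{j=i+1}^n\big[F_{(i)j}^{(1)}\big]^2$. "Produced by the system" (with no metrics mentioned) means: produced by the system and the Euclidean pair $\mathcal P=\Delta=(h_{11}=1,\varphi_{ij}=\delta_{ij})$. "Produced by the superior order ODE" means produced by its equivalent first order system. *)

theory Defs
  imports "HOL-Analysis.Analysis"
begin

text \<open>
  Vectors of \<open>R^n\<close> are functions on \<open>nat\<close> of which only the values at the indices
  \<open>1, ..., n\<close> matter; upper and lower indices are both written as arguments, upper ones first.
  A point of the jet space \<open>J^1(T, R^n)\<close> is given by its coordinates \<open>t\<close>, \<open>x\<close>, \<open>v\<close>,
  where \<open>v i\<close> stands for \<open>x_1^i\<close>.
\<close>

type_synonym vect = "nat \<Rightarrow> real"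
type_synonym time_metric = "real \<Rightarrow> real"
type_synonym space_metric = "vect \<Rightarrow> nat \<Rightarrow> nat \<Rightarrow> real"
type_synonym ode_system = "real \<Rightarrow> vect \<Rightarrow> vect"

section \<open>Derivatives\<close>

text \<open>The derivative is taken within \<open>T\<close>, hence is one-sided at the end points of an interval.\<close>

definition time_deriv :: "real set \<Rightarrow> (real \<Rightarrow> real) \<Rightarrow> real \<Rightarrow> real" where
  "time_deriv T f t = vector_derivative f (at t within T)"

definition nth_time_deriv :: "real set \<Rightarrow> nat \<Rightarrow> (real \<Rightarrow> real) \<Rightarrow> real \<Rightarrow> real" where
  "nth_time_deriv T k f = (time_deriv T ^^ k) f"

definition smooth_fun_on :: "real set \<Rightarrow> (real \<Rightarrow> real) \<Rightarrow> bool" where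
  "smooth_fun_on T f \<longleftrightarrow> (\<forall>k. \<forall>t\<in>T. nth_time_deriv T k f differentiable (at t within T))"

definition partial_deriv :: "nat \<Rightarrow> (vect \<Rightarrow> real) \<Rightarrow> vect \<Rightarrow> real" where
  "partial_deriv j f x = deriv (\<lambda>s. f (x(j := s))) (x j)"

section \<open>A pair of metrics\<close>

definition inv_metric :: "nat \<Rightarrow> space_metric \<Rightarrow> vect \<Rightarrow> nat \<Rightarrow> nat \<Rightarrow> real" where
  "inv_metric n \<phi> x = (SOME \<psi>. \<forall>i\<in>{1..n}. \<forall>j\<in>{1..n}.
      (\<Sum>k=1..n. \<psi> i k * \<phi> x k j) = (if i = j then 1 else 0) \<and>
      (\<Sum>k=1..n. \<phi> x i k * \<psi> k j) = (if i = j then 1 else 0))"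

definition time_christoffel :: "real set \<Rightarrow> time_metric \<Rightarrow> real \<Rightarrow> real" where
  "time_christoffel T h t = (1 / h t) / 2 * time_deriv T h t"

definition christoffel :: "nat \<Rightarrow> space_metric \<Rightarrow> nat \<Rightarrow> nat \<Rightarrow> nat \<Rightarrow> vect \<Rightarrow> real" where
  "christoffel n \<phi> i j k x = (1/2) * (\<Sum>m=1..n. inv_metric n \<phi> x i m *
      (partial_deriv k (\<lambda>y. \<phi> y j m) x + partial_deriv j (\<lambda>y. \<phi> y k m) x
        - partial_deriv m (\<lambda>y. \<phi> y j k) x))"

text \<open>Sign and index convention: \<open>riemann n \<phi> l i j k\<close> is skew-symmetric in \<open>j\<close> and \<open>k\<close>.\<close>

definition riemann :: "nat \<Rightarrow> space_metric \<Rightarrow> nat \<Rightarrow> nat \<Rightarrow> nat \<Rightarrow> nat \<Rightarrow> vect \<Rightarrow> real" where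
  "riemann n \<phi> l i j k x =
     partial_deriv k (christoffel n \<phi> l i j) x - partial_deriv j (christoffel n \<phi> l i k) x
     + (\<Sum>m=1..n. christoffel n \<phi> m i j x * christoffel n \<phi> l m k x
         - christoffel n \<phi> m i k x * christoffel n \<phi> l m j x)"

definition euclid_time :: time_metric where
  "euclid_time t = 1"

definition euclid_space :: space_metric where
  "euclid_space x i j = (if i = j then 1 else 0)"

section \<open>Covariant derivatives of the d-tensor field of a system\<close>

definition cov :: "nat \<Rightarrow> space_metric \<Rightarrow> ode_system \<Rightarrow> nat \<Rightarrow> nat \<Rightarrow> real \<Rightarrow> vect \<Rightarrow> real" where
  "cov n \<phi> X i j t x = partial_deriv j (\<lambda>y. X t y i) x
     + (\<Sum>m=1..n. X t x m * christoffel n \<phi> i m j x)"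

definition cov_time :: "nat \<Rightarrow> real set \<Rightarrow> time_metric \<Rightarrow> space_metric \<Rightarrow> ode_system
    \<Rightarrow> nat \<Rightarrow> nat \<Rightarrow> real \<Rightarrow> vect \<Rightarrow> real" where
  "cov_time n T h \<phi> X i j t x = time_deriv T (\<lambda>s. cov n \<phi> X i j s x) t
     - cov n \<phi> X i j t x * time_christoffel T h t"

definition cov_space :: "nat \<Rightarrow> space_metric \<Rightarrow> ode_system
    \<Rightarrow> nat \<Rightarrow> nat \<Rightarrow> nat \<Rightarrow> real \<Rightarrow> vect \<Rightarrow> real" where
  "cov_space n \<phi> X i j k t x = partial_deriv k (\<lambda>y. cov n \<phi> X i j t y) x
     + (\<Sum>m=1..n. cov n \<phi> X m j t x * christoffel n \<phi> i m k x)
     - (\<Sum>m=1..n. cov n \<phi> X i m t x * christoffel n \<phi> m j k x)"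

section \<open>Geometrical objects produced by a system and a pair of metrics\<close>

definition nlc_M :: "real set \<Rightarrow> time_metric \<Rightarrow> real \<Rightarrow> vect \<Rightarrow> nat \<Rightarrow> real" where
  "nlc_M T h t v i = - time_christoffel T h t * v i"

definition nlc_N :: "nat \<Rightarrow> space_metric \<Rightarrow> ode_system
    \<Rightarrow> real \<Rightarrow> vect \<Rightarrow> vect \<Rightarrow> nat \<Rightarrow> nat \<Rightarrow> real" where
  "nlc_N n \<phi> X t x v i j = (\<Sum>k=1..n. christoffel n \<phi> i j k x * v k)
     - (1/2) * (cov n \<phi> X i j t x
         - (\<Sum>r=1..n. \<Sum>s=1..n. inv_metric n \<phi> x i r * cov n \<phi> X s r t x * \<phi> x s j))"

text \<open>
  The four families of adapted components of an \<open>h\<close>-normal linear connection: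
  \<open>H_{11}^1\<close>, \<open>G_{j1}^i\<close>, \<open>L_{jk}^i\<close> and \<open>C_{j(k)}^{i(1)}\<close>.
\<close>

record linear_connection =
  conn_H :: real
  conn_G :: "nat \<Rightarrow> nat \<Rightarrow> real"
  conn_L :: "nat \<Rightarrow> nat \<Rightarrow> nat \<Rightarrow> real"
  conn_C :: "nat \<Rightarrow> nat \<Rightarrow> nat \<Rightarrow> real"

definition cartan_connection :: "nat \<Rightarrow> real set \<Rightarrow> time_metric \<Rightarrow> space_metric
    \<Rightarrow> real \<Rightarrow> vect \<Rightarrow> linear_connection" where
  "cartan_connection n T h \<phi> t x =
     \<lparr> conn_H = time_christoffel T h t,
       conn_G = (\<lambda>i j. 0),
       conn_L = (\<lambda>i j k. christoffel n \<phi> i j k x),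
       conn_C = (\<lambda>i j k. 0) \<rparr>"

text \<open>
  Indices of the adapted basis \<open>\<delta>/\<delta>t\<close>, \<open>\<delta>/\<delta>x^i\<close>, \<open>\<partial>/\<partial>x_1^i\<close>. Torsion and curvature are
  skew-symmetric in two of their lower indices, so that their adapted components are labelled by
  only one ordering of the kinds of these two indices, and none is needed for two time indices.
\<close>

datatype adapted_index = Time | Space nat | Fibre nat

datatype adapted_pair =
    TimeSpace nat | TimeFibre nat
  | SpaceSpace nat nat | SpaceFibre nat nat | FibreFibre nat nat

fun index_in_range :: "nat \<Rightarrow> adapted_index \<Rightarrow> bool" where
  "index_in_range n Time \<longleftrightarrow> True"
| "index_in_range n (Space i) \<longleftrightarrow> i \<in> {1..n}"
| "index_in_range n (Fibre i) \<longleftrightarrow> i \<in> {1..n}"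

fun pair_in_range :: "nat \<Rightarrow> adapted_pair \<Rightarrow> bool" where
  "pair_in_range n (TimeSpace j) \<longleftrightarrow> j \<in> {1..n}"
| "pair_in_range n (TimeFibre j) \<longleftrightarrow> j \<in> {1..n}"
| "pair_in_range n (SpaceSpace j k) \<longleftrightarrow> j \<in> {1..n} \<and> k \<in> {1..n}"
| "pair_in_range n (SpaceFibre j k) \<longleftrightarrow> j \<in> {1..n} \<and> k \<in> {1..n}"
| "pair_in_range n (FibreFibre j k) \<longleftrightarrow> j \<in> {1..n} \<and> k \<in> {1..n}"

definition torsion_temporal :: "nat \<Rightarrow> real set \<Rightarrow> time_metric \<Rightarrow> space_metric \<Rightarrow> ode_system
    \<Rightarrow> real \<Rightarrow> vect \<Rightarrow> nat \<Rightarrow> nat \<Rightarrow> real" where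
  "torsion_temporal n T h \<phi> X t x i j = (1/2) * (cov_time n T h \<phi> X i j t x
     - (\<Sum>r=1..n. \<Sum>s=1..n. inv_metric n \<phi> x i r * cov_time n T h \<phi> X s r t x * \<phi> x s j))"

definition torsion_spatial :: "nat \<Rightarrow> space_metric \<Rightarrow> ode_system
    \<Rightarrow> real \<Rightarrow> vect \<Rightarrow> vect \<Rightarrow> nat \<Rightarrow> nat \<Rightarrow> nat \<Rightarrow> real" where
  "torsion_spatial n \<phi> X t x v i j k = (\<Sum>m=1..n. riemann n \<phi> i j k m x * v m)
     - (1/2) * (cov_space n \<phi> X i j k t x
         - (\<Sum>r=1..n. \<Sum>s=1..n. inv_metric n \<phi> x i r * cov_space n \<phi> X s r k t x * \<phi> x s j))"

fun torsion :: "nat \<Rightarrow> real set \<Rightarrow> time_metric \<Rightarrow> space_metric \<Rightarrow> ode_system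
    \<Rightarrow> real \<Rightarrow> vect \<Rightarrow> vect \<Rightarrow> adapted_index \<Rightarrow> adapted_pair \<Rightarrow> real" where
  "torsion n T h \<phi> X t x v (Fibre i) (TimeSpace j) = torsion_temporal n T h \<phi> X t x i j"
| "torsion n T h \<phi> X t x v (Fibre i) (SpaceSpace j k) = torsion_spatial n \<phi> X t x v i j k"
| "torsion n T h \<phi> X t x v _ _ = 0"

text \<open>
  In \<open>curvature n \<phi> x A B P\<close>, the upper index is \<open>A\<close>, the first lower index is \<open>B\<close>, and \<open>P\<close>
  labels the last two lower indices.
\<close>

fun curvature :: "nat \<Rightarrow> space_metric \<Rightarrow> vect
    \<Rightarrow> adapted_index \<Rightarrow> adapted_index \<Rightarrow> adapted_pair \<Rightarrow> real" where
  "curvature n \<phi> x (Space l) (Space i) (SpaceSpace j k) = riemann n \<phi> l i j k x"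
| "curvature n \<phi> x _ _ _ = 0"

text \<open>
  Differential forms on \<open>J^1(T, R^n)\<close> at a point act on tangent vectors, which are given by
  their components with respect to \<open>\<partial>/\<partial>t\<close>, \<open>\<partial>/\<partial>x^i\<close>, \<open>\<partial>/\<partial>x_1^i\<close>.
\<close>

type_synonym tangent = "real \<times> vect \<times> vect"

definition form_dt :: "tangent \<Rightarrow> real" where
  "form_dt w = fst w"

definition form_dx :: "nat \<Rightarrow> tangent \<Rightarrow> real" where
  "form_dx i w = fst (snd w) i"

definition form_dx1 :: "nat \<Rightarrow> tangent \<Rightarrow> real" where
  "form_dx1 i w = snd (snd w) i"

definition wedge :: "(tangent \<Rightarrow> real) \<Rightarrow> (tangent \<Rightarrow> real) \<Rightarrow> tangent \<Rightarrow> tangent \<Rightarrow> real" where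
  "wedge \<alpha> \<beta> w w' = \<alpha> w * \<beta> w' - \<alpha> w' * \<beta> w"

definition delta_x1 :: "nat \<Rightarrow> real set \<Rightarrow> time_metric \<Rightarrow> space_metric \<Rightarrow> ode_system
    \<Rightarrow> real \<Rightarrow> vect \<Rightarrow> vect \<Rightarrow> nat \<Rightarrow> tangent \<Rightarrow> real" where
  "delta_x1 n T h \<phi> X t x v i w = form_dx1 i w + nlc_M T h t v i * form_dt w
     + (\<Sum>k=1..n. nlc_N n \<phi> X t x v i k * form_dx k w)"

definition em_component :: "nat \<Rightarrow> time_metric \<Rightarrow> space_metric \<Rightarrow> ode_system
    \<Rightarrow> real \<Rightarrow> vect \<Rightarrow> nat \<Rightarrow> nat \<Rightarrow> real" where
  "em_component n h \<phi> X t x i j = (1 / h t) / 2 *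
     ((\<Sum>m=1..n. \<phi> x i m * cov n \<phi> X m j t x) - (\<Sum>m=1..n. \<phi> x j m * cov n \<phi> X m i t x))"

definition em_form :: "nat \<Rightarrow> real set \<Rightarrow> time_metric \<Rightarrow> space_metric \<Rightarrow> ode_system
    \<Rightarrow> real \<Rightarrow> vect \<Rightarrow> vect \<Rightarrow> tangent \<Rightarrow> tangent \<Rightarrow> real" where
  "em_form n T h \<phi> X t x v w w' = (\<Sum>i=1..n. \<Sum>j=1..n.
     em_component n h \<phi> X t x i j * wedge (delta_x1 n T h \<phi> X t x v i) (form_dx j) w w')"

definition EYM :: "nat \<Rightarrow> time_metric \<Rightarrow> space_metric \<Rightarrow> ode_system \<Rightarrow> real \<Rightarrow> vect \<Rightarrow> real" where
  "EYM n h \<phi> X t x = (\<Sum>i=1..n-1. \<Sum>j=i+1..n. (em_component n h \<phi> X t x i j)\<^sup>2)"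

section \<open>Linear differential equations of order \<open>n\<close>\<close>

definition solves_system :: "nat \<Rightarrow> real set \<Rightarrow> ode_system \<Rightarrow> (real \<Rightarrow> vect) \<Rightarrow> bool" where
  "solves_system n T X x \<longleftrightarrow> (\<forall>t\<in>T. \<forall>i\<in>{1..n}.
     ((\<lambda>s. x s i) has_vector_derivative X t (x t) i) (at t within T))"

definition solves_linear_ode :: "nat \<Rightarrow> real set \<Rightarrow> (nat \<Rightarrow> real \<Rightarrow> real) \<Rightarrow> (real \<Rightarrow> real)
    \<Rightarrow> (real \<Rightarrow> real) \<Rightarrow> bool" where
  "solves_linear_ode n T coef rhs y \<longleftrightarrow>
     (\<forall>k<n. \<forall>t\<in>T. nth_time_deriv T k y differentiable (at t within T)) \<and>
     (\<forall>t\<in>T. (\<Sum>k=0..n. coef k t * nth_time_deriv T (n - k) y t) = rhs t)"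

definition linear_ode_system :: "nat \<Rightarrow> (nat \<Rightarrow> real \<Rightarrow> real) \<Rightarrow> (real \<Rightarrow> real) \<Rightarrow> ode_system" where
  "linear_ode_system n coef rhs t x i =
     (if i < n then x (i + 1)
      else rhs t / coef 0 t - (\<Sum>k=1..n. coef (n + 1 - k) t / coef 0 t * x k))"

definition ode_B_upper :: "nat \<Rightarrow> (nat \<Rightarrow> real \<Rightarrow> real) \<Rightarrow> real \<Rightarrow> nat \<Rightarrow> nat \<Rightarrow> real" where
  "ode_B_upper n coef t i j =
     (if j = n then (if i = n - 1 then 1 + coef 2 t / coef 0 t else coef (n + 1 - i) t / coef 0 t)
      else if j = i + 1 then 1 else 0)"

definition ode_B :: "nat \<Rightarrow> (nat \<Rightarrow> real \<Rightarrow> real) \<Rightarrow> real \<Rightarrow> nat \<Rightarrow> nat \<Rightarrow> real" where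
  "ode_B n coef t i j =
     (if i < j then ode_B_upper n coef t i j
      else if j < i then - ode_B_upper n coef t j i
      else 0)"

definition ode_N :: "nat \<Rightarrow> (nat \<Rightarrow> real \<Rightarrow> real) \<Rightarrow> real \<Rightarrow> nat \<Rightarrow> nat \<Rightarrow> real" where
  "ode_N n coef t i j = - (1/2) * ode_B n coef t i j"

end

theory Submission
  imports Defs
begin

text \<open>
  With the Euclidean metrics all Christoffel symbols vanish, covariant derivatives become
  partial derivatives, and raising and lowering indices transposes a matrix. Every object produced
  by a system \<open>X\<close> is then governed by \<open>J - J\<^sup>T\<close>, where \<open>J = (\<partial>X^i/\<partial>x^j)\<close> is the
  Jacobian matrix, which the covariant derivative \<open>cov\<close> has become: the non-linear connection is
  \<open>-1/2\<close> times \<open>J - J\<^sup>T\<close>, the electromagnetic components are \<open>1/2\<close> times it, and the temporal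
  and spatial torsions are \<open>1/2\<close> times its \<open>t\<close>-derivative and \<open>-1/2\<close> times its
  \<open>x\<close>-derivatives (lemmas \<open>nlc_N_euclid\<close>, \<open>em_component_euclid\<close>,
  \<open>torsion_temporal_euclid\<close>, \<open>torsion_spatial_euclid\<close>).

  For a linear equation of order \<open>n\<close> the system is affine in \<open>x\<close>, and \<open>J\<close> is the companion
  matrix, which depends on \<open>t\<close> alone and has constant entries outside its last row. Hence the
  spatial torsion vanishes, the temporal torsion lives in the last row and column, where the
  quotient rule gives it, and \<open>B = J - J\<^sup>T\<close>. The Yang-Mills energy is a quarter of the sum of
  the squares of the entries of \<open>B\<close> above the diagonal; the mixed term \<open>2 a_2/a_0\<close> arises
  because at \<open>(n-1, n)\<close> the superdiagonal entry \<open>1\<close> and the entry \<open>a_2/a_0\<close> of the last column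
  are added.

  The equation and its system are equivalent because the first \<open>n-1\<close> equations of the
  system say that each component is the derivative of the preceding one, and the last one is the
  equation solved for \<open>y^{(n)}\<close>.
\<close>

section \<open>Derivatives within a compact interval\<close>

lemma time_deriv_eqI:
  assumes "a < b" "t \<in> {a..b}" "(f has_vector_derivative D) (at t within {a..b})"
  shows "time_deriv {a..b} f t = D"
  unfolding time_deriv_def by (rule vector_derivative_within_closed_interval) (use assms in auto)

lemma has_vector_derivative_time_deriv:
  assumes "f differentiable (at t within T)"
  shows "(f has_vector_derivative time_deriv T f t) (at t within T)"
  using assms unfolding time_deriv_def by (simp add: vector_derivative_works)

lemma time_deriv_const:
  assumes "a < b" "t \<in> {a..b}"
  shows "time_deriv {a..b} (\<lambda>s. c) t = 0"
  by (rule time_deriv_eqI) (use assms in auto)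

lemma time_deriv_uminus_quotient:
  assumes "a < b" "t \<in> {a..b}"
    and f: "f differentiable (at t within {a..b})"
    and g: "g differentiable (at t within {a..b})" "g t \<noteq> 0"
  shows "time_deriv {a..b} (\<lambda>s. - (f s / g s)) t
    = - ((time_deriv {a..b} f t * g t - f t * time_deriv {a..b} g t) / (g t)\<^sup>2)"
proof (rule time_deriv_eqI[OF assms(1,2)])
  have "(f has_field_derivative time_deriv {a..b} f t) (at t within {a..b})"
    and "(g has_field_derivative time_deriv {a..b} g t) (at t within {a..b})"
    using f g has_vector_derivative_time_deriv
    by (auto simp: has_real_derivative_iff_has_vector_derivative)
  then have "((\<lambda>s. - (f s / g s)) has_field_derivative
      - ((time_deriv {a..b} f t * g t - f t * time_deriv {a..b} g t) / (g t * g t)))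
      (at t within {a..b})"
    by (intro DERIV_minus DERIV_divide g(2))
  then show "((\<lambda>s. - (f s / g s)) has_vector_derivative
      - ((time_deriv {a..b} f t * g t - f t * time_deriv {a..b} g t) / (g t)\<^sup>2))
      (at t within {a..b})"
    by (simp add: has_real_derivative_iff_has_vector_derivative power2_eq_square)
qed

lemma nth_time_deriv_0 [simp]: "nth_time_deriv T 0 f = f"
  by (simp add: nth_time_deriv_def)

lemma nth_time_deriv_Suc: "nth_time_deriv T (Suc k) f t = time_deriv T (nth_time_deriv T k f) t"
  by (simp add: nth_time_deriv_def)

lemma smooth_fun_on_differentiable:
  assumes "smooth_fun_on T f" "t \<in> T"
  shows "f differentiable (at t within T)"
  using assms unfolding smooth_fun_on_def by (metis nth_time_deriv_0)

lemma partial_deriv_const [simp]: "partial_deriv j (\<lambda>y. c) x = 0"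
  by (simp add: partial_deriv_def)

lemma partial_deriv_coordinate: "partial_deriv j (\<lambda>y. y i) x = (if j = i then 1 else 0)"
  by (simp add: partial_deriv_def)

lemma partial_deriv_affine:
  assumes "j \<in> {1..n}"
  shows "partial_deriv j (\<lambda>y. d - (\<Sum>k=1..n. c k * y k)) x = - c j"
proof -
  have "((\<lambda>s. d - (\<Sum>k=1..n. c k * (x(j := s)) k)) has_field_derivative
      0 - (\<Sum>k=1..n. if k = j then c k else 0)) (at (x j))"
  proof (intro DERIV_diff DERIV_const DERIV_sum)
    fix k
    show "((\<lambda>s. c k * (x(j := s)) k) has_field_derivative (if k = j then c k else 0)) (at (x j))"
      by (cases "k = j") (auto intro!: derivative_eq_intros)
  qed
  moreover have "(\<Sum>k=1..n. if k = j then c k else 0) = c j"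
    using assms by simp
  ultimately show ?thesis
    unfolding partial_deriv_def by (simp add: DERIV_imp_deriv)
qed

section \<open>Geometry of a system for the Euclidean metrics\<close>

lemma sum_euclid_space:
  assumes "k \<in> {1..n}"
  shows "(\<Sum>m=1..n. euclid_space x k m * f m) = f k"
    and "(\<Sum>m=1..n. f m * euclid_space x m k) = f k"
proof -
  have "(\<Sum>m=1..n. euclid_space x k m * f m) = (\<Sum>m=1..n. if m = k then f m else 0)"
    and "(\<Sum>m=1..n. f m * euclid_space x m k) = (\<Sum>m=1..n. if m = k then f m else 0)"
    by (intro sum.cong refl; simp add: euclid_space_def)+
  then show "(\<Sum>m=1..n. euclid_space x k m * f m) = f k"
    and "(\<Sum>m=1..n. f m * euclid_space x m k) = f k"
    using assms by simp_all
qed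

text \<open>
  The inverse metric is a choice among all functions that invert the metric on the index range, so
  that it is pinned down on this range only.
\<close>

lemma inv_metric_euclid:
  assumes i: "i \<in> {1..n}" and j: "j \<in> {1..n}"
  shows "inv_metric n euclid_space x i j = (if i = j then 1 else 0)"
proof -
  define P where "P \<psi> \<longleftrightarrow> (\<forall>i\<in>{1..n}. \<forall>j\<in>{1..n}.
      (\<Sum>k=1..n. \<psi> i k * euclid_space x k j) = (if i = j then 1 else 0) \<and>
      (\<Sum>k=1..n. euclid_space x i k * \<psi> k j) = (if i = j then 1 else 0))"
    for \<psi> :: "nat \<Rightarrow> nat \<Rightarrow> real"
  have "P (\<lambda>i j. if i = j then 1 else 0)"
    unfolding P_def by (simp add: sum_euclid_space del: One_nat_def)
  then have "P (SOME \<psi>. P \<psi>)"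
    by (rule someI[of P])
  then have "P (inv_metric n euclid_space x)"
    unfolding inv_metric_def P_def .
  then show ?thesis
    using i j sum_euclid_space(2)[OF j] unfolding P_def by metis
qed

text \<open>
  Raising one index of a matrix and lowering the other is what the second terms of the non-linear
  connection and of the torsions do; with \<open>A\<close> the array \<open>cov\<close> or one of its derivatives,
  each of these terms becomes a transpose.
\<close>

lemma euclid_transpose:
  assumes "i \<in> {1..n}" "j \<in> {1..n}"
  shows "(\<Sum>r=1..n. \<Sum>s=1..n. inv_metric n euclid_space x i r * A s r * euclid_space x s j) = A j i"
proof -
  have "(\<Sum>r=1..n. \<Sum>s=1..n. inv_metric n euclid_space x i r * A s r * euclid_space x s j)
      = (\<Sum>r=1..n. \<Sum>s=1..n. if r = i then if s = j then A s r else 0 else 0)"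
    using assms by (intro sum.cong refl) (auto simp: inv_metric_euclid euclid_space_def)
  also have "\<dots> = (\<Sum>r=1..n. if r = i then A j r else 0)"
    using assms by (intro sum.cong refl) auto
  also have "\<dots> = A j i"
    using assms by simp
  finally show ?thesis .
qed

lemma christoffel_euclid: "christoffel n euclid_space i j k = (\<lambda>x. 0)"
  by (rule ext) (simp add: christoffel_def euclid_space_def)

lemma riemann_euclid: "riemann n euclid_space l i j k x = 0"
  by (simp add: riemann_def christoffel_euclid)

lemma time_christoffel_euclid:
  assumes "a < b" "t \<in> {a..b}"
  shows "time_christoffel {a..b} euclid_time t = 0"
  by (simp add: time_christoffel_def euclid_time_def[abs_def] time_deriv_const[OF assms])

lemma cov_euclid: "cov n euclid_space X i j t x = partial_deriv j (\<lambda>y. X t y i) x"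
  by (simp add: cov_def christoffel_euclid)

lemma nlc_N_euclid:
  assumes "i \<in> {1..n}" "j \<in> {1..n}"
  shows "nlc_N n euclid_space X t x v i j
    = - (1/2) * (cov n euclid_space X i j t x - cov n euclid_space X j i t x)"
  by (simp add: nlc_N_def christoffel_euclid
      euclid_transpose[OF assms, where A = "\<lambda>s r. cov n euclid_space X s r t x"] del: One_nat_def)

lemma em_component_euclid:
  assumes "i \<in> {1..n}" "j \<in> {1..n}"
  shows "em_component n euclid_time euclid_space X t x i j
    = (1/2) * (cov n euclid_space X i j t x - cov n euclid_space X j i t x)"
  using assms by (simp add: em_component_def euclid_time_def sum_euclid_space del: One_nat_def)

lemma torsion_temporal_euclid:
  assumes "a < b" "t \<in> {a..b}" and ij: "i \<in> {1..n}" "j \<in> {1..n}"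
  shows "torsion_temporal n {a..b} euclid_time euclid_space X t x i j
    = (1/2) * (time_deriv {a..b} (\<lambda>s. cov n euclid_space X i j s x) t
        - time_deriv {a..b} (\<lambda>s. cov n euclid_space X j i s x) t)"
  by (simp add: torsion_temporal_def cov_time_def time_christoffel_euclid[OF assms(1,2)]
      euclid_transpose[OF ij,
        where A = "\<lambda>s r. time_deriv {a..b} (\<lambda>u. cov n euclid_space X s r u x) t"] del: One_nat_def)

lemma torsion_spatial_euclid:
  assumes ij: "i \<in> {1..n}" "j \<in> {1..n}"
  shows "torsion_spatial n euclid_space X t x v i j k
    = - (1/2) * (partial_deriv k (cov n euclid_space X i j t) x
        - partial_deriv k (cov n euclid_space X j i t) x)"
  by (simp add: torsion_spatial_def cov_space_def christoffel_euclid riemann_euclid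
      euclid_transpose[OF ij, where A = "\<lambda>s r. partial_deriv k (cov n euclid_space X s r t) x"] del: One_nat_def)

section \<open>The Jacobian matrix of a linear equation\<close>

definition companion :: "nat \<Rightarrow> (nat \<Rightarrow> real \<Rightarrow> real) \<Rightarrow> nat \<Rightarrow> nat \<Rightarrow> real \<Rightarrow> real" where
  "companion n coef i j t =
     (if i < n then if j = i + 1 then 1 else 0 else - (coef (n + 1 - j) t / coef 0 t))"

lemma cov_linear_ode_system:
  assumes "j \<in> {1..n}"
  shows "cov n euclid_space (linear_ode_system n coef rhs) i j t x = companion n coef i j t"
proof (cases "i < n")
  case True
  then show ?thesis
    by (simp add: cov_euclid linear_ode_system_def companion_def partial_deriv_coordinate)
next
  case False
  then show ?thesis
    using partial_deriv_affine[OF assms, of "rhs t / coef 0 t" "\<lambda>k. coef (n + 1 - k) t / coef 0 t" x]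
    by (simp add: cov_euclid linear_ode_system_def companion_def)
qed

text \<open>
  At \<open>(n-1, n)\<close> the superdiagonal entry \<open>1\<close> of the companion matrix is met by the entry
  \<open>-a_2/a_0\<close> of its last row at the transposed position; this explains the exceptional entry
  \<open>1 + a_2/a_0\<close> of \<open>B\<close>.
\<close>

lemma ode_B_eq_skew_companion:
  assumes "n \<ge> 2" "i \<in> {1..n}" "j \<in> {1..n}"
  shows "ode_B n coef t i j = companion n coef i j t - companion n coef j i t"
proof -
  have upper: "ode_B_upper n coef t i j = companion n coef i j t - companion n coef j i t"
    if "i \<in> {1..n}" "j \<in> {1..n}" "i < j" for i j
  proof -
    have "n + 1 - i = 2" if "i = n - 1" using that assms(1) by simp
    then show ?thesis
      using that by (auto simp: ode_B_upper_def companion_def)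
  qed
  show ?thesis
    using assms(2,3) upper[of i j] upper[of j i] by (auto simp: ode_B_def not_less_iff_gr_or_eq)
qed

lemma ode_N_skew: "ode_N n coef t i j = - ode_N n coef t j i"
  by (simp add: ode_N_def ode_B_def)

lemma nlc_N_linear_ode:
  assumes "n \<ge> 2" "i \<in> {1..n}" "j \<in> {1..n}"
  shows "nlc_N n euclid_space (linear_ode_system n coef rhs) t x v i j = ode_N n coef t i j"
  using assms by (simp add: nlc_N_euclid cov_linear_ode_system ode_N_def ode_B_eq_skew_companion)

lemma em_component_linear_ode:
  assumes "n \<ge> 2" "i \<in> {1..n}" "j \<in> {1..n}"
  shows "em_component n euclid_time euclid_space (linear_ode_system n coef rhs) t x i j
    = - ode_N n coef t i j"
  using assms
  by (simp add: em_component_euclid cov_linear_ode_system ode_N_def ode_B_eq_skew_companion)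

section \<open>Torsion and curvature\<close>

lemma torsion_temporal_linear_ode:
  assumes "a < b" "t \<in> {a..b}" "i \<in> {1..n}" "j \<in> {1..n}"
  shows "torsion_temporal n {a..b} euclid_time euclid_space (linear_ode_system n coef rhs) t x i j
    = (1/2) * (time_deriv {a..b} (companion n coef i j) t
        - time_deriv {a..b} (companion n coef j i) t)"
  using assms(3,4) by (simp add: torsion_temporal_euclid[OF assms] cov_linear_ode_system)

lemma torsion_temporal_linear_ode_skew:
  assumes "a < b" "t \<in> {a..b}" "i \<in> {1..n}" "j \<in> {1..n}"
  shows "torsion_temporal n {a..b} euclid_time euclid_space (linear_ode_system n coef rhs) t x i j
    = - torsion_temporal n {a..b} euclid_time euclid_space (linear_ode_system n coef rhs) t x j i"
  using assms by (simp add: torsion_temporal_linear_ode field_simps)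

lemma time_deriv_companion_upper:
  assumes "a < b" "t \<in> {a..b}" "i < n"
  shows "time_deriv {a..b} (companion n coef i j) t = 0"
proof -
  have "companion n coef i j = (\<lambda>s. if j = i + 1 then 1 else 0)"
    using assms(3) by (auto simp: companion_def)
  then show ?thesis
    by (simp only: time_deriv_const[OF assms(1,2)])
qed

lemma torsion_temporal_linear_ode_zero:
  assumes "a < b" "t \<in> {a..b}" "i \<in> {1..n}" "j \<in> {1..n}"
    and ij: "(i < n \<and> j < n) \<or> (i = n \<and> j = n)"
  shows "torsion_temporal n {a..b} euclid_time euclid_space (linear_ode_system n coef rhs) t x i j = 0"
  using ij torsion_temporal_linear_ode[OF assms(1-4)] time_deriv_companion_upper[OF assms(1,2)]
  by auto

text \<open>
  Above the last row the companion matrix is constant, so that only the derivative of the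
  transposed entry \<open>-a_k/a_0\<close>, where \<open>k = n - i + 1\<close>, remains. The two minus signs cancel.
\<close>

lemma torsion_temporal_linear_ode_last_column:
  assumes "a < b" "t \<in> {a..b}" and i: "i \<in> {1..n-1}"
    and diff: "coef (n - i + 1) differentiable (at t within {a..b})"
      "coef 0 differentiable (at t within {a..b})"
    and nz: "coef 0 t \<noteq> 0"
  shows "torsion_temporal n {a..b} euclid_time euclid_space (linear_ode_system n coef rhs) t x i n
    = (time_deriv {a..b} (coef (n - i + 1)) t * coef 0 t
        - coef (n - i + 1) t * time_deriv {a..b} (coef 0) t) / (2 * (coef 0 t)\<^sup>2)"
proof -
  have ranges: "i \<in> {1..n}" "n \<in> {1..n}" "i < n" using i by auto
  have "companion n coef n i = (\<lambda>s. - (coef (n - i + 1) s / coef 0 s))"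
    using ranges by (auto simp: companion_def Suc_diff_le)
  then show ?thesis
    by (simp add: torsion_temporal_linear_ode[OF assms(1,2) ranges(1,2)]
        time_deriv_companion_upper[OF assms(1,2) ranges(3)]
        time_deriv_uminus_quotient[OF assms(1,2) diff nz, simplified])
qed

text \<open>The system is affine in \<open>x\<close>, hence its Jacobian matrix does not depend on \<open>x\<close>.\<close>

lemma torsion_spatial_linear_ode:
  assumes "i \<in> {1..n}" "j \<in> {1..n}"
  shows "torsion_spatial n euclid_space (linear_ode_system n coef rhs) t x v i j k = 0"
proof -
  have "cov n euclid_space (linear_ode_system n coef rhs) r s t = (\<lambda>x. companion n coef r s t)"
    if "s \<in> {1..n}" for r s
    using that by (auto simp: cov_linear_ode_system)
  then show ?thesis
    using assms by (simp add: torsion_spatial_euclid)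
qed

lemma torsion_linear_ode_zero:
  assumes "a < b" "t \<in> {a..b}" "index_in_range n A" "pair_in_range n P"
    and not_exceptional:
      "\<not> (\<exists>i\<in>{1..n-1}. (A = Fibre i \<and> P = TimeSpace n) \<or> (A = Fibre n \<and> P = TimeSpace i))"
  shows "torsion n {a..b} euclid_time euclid_space (linear_ode_system n coef rhs) t x v A P = 0"
proof (cases A)
  case (Fibre i)
  then have i: "i \<in> {1..n}" using assms(3) by simp
  show ?thesis
  proof (cases P)
    case (TimeSpace j)
    then have j: "j \<in> {1..n}" using assms(4) by simp
    have "(i < n \<and> j < n) \<or> (i = n \<and> j = n)"
      using not_exceptional i j Fibre TimeSpace by force
    then show ?thesis
      using torsion_temporal_linear_ode_zero[OF assms(1,2) i j] Fibre TimeSpace by simp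
  next
    case (SpaceSpace j k)
    then show ?thesis
      using assms(4) torsion_spatial_linear_ode[OF i] Fibre by simp
  qed (use Fibre in simp_all)
qed simp_all

lemma curvature_euclid: "curvature n euclid_space x A B P = 0"
  by (cases "(n, euclid_space, x, A, B, P)" rule: curvature.cases) (simp_all add: riemann_euclid)

section \<open>Yang-Mills energy\<close>

text \<open>
  Expanding the square separates the superdiagonal of the matrix from its last column; the two meet
  only in row \<open>n - 1\<close>, which contributes the mixed term.
\<close>

lemma ode_B_row_energy:
  assumes i: "i \<in> {1..n-1}"
  shows "(\<Sum>j=i+1..n. (ode_B n coef t i j)\<^sup>2)
    = 1 + (coef (n + 1 - i) t / coef 0 t)\<^sup>2
      + (if i = n - 1 then 2 * (coef 2 t / coef 0 t) else 0)"
proof -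
  let ?q = "coef (n + 1 - i) t / coef 0 t"
  let ?m = "if i = n - 1 then 2 * (coef 2 t / coef 0 t) else 0"
  have i_less: "Suc i \<le> n" "Suc 0 \<le> n" using i by auto
  have "n + 1 - i = 2" if "i = n - 1" using that i by auto
  then have "(ode_B n coef t i j)\<^sup>2
      = (if j = i + 1 then 1 else 0) + (if j = n then ?q\<^sup>2 else 0) + (if j = n then ?m else 0)"
    if "j \<in> {i+1..n}" for j
    using that i by (auto simp: ode_B_def ode_B_upper_def power2_sum)
  then have "(\<Sum>j=i+1..n. (ode_B n coef t i j)\<^sup>2) = (\<Sum>j=i+1..n.
      (if j = i + 1 then 1 else 0) + (if j = n then ?q\<^sup>2 else 0) + (if j = n then ?m else 0))"
    by (intro sum.cong refl)
  also have "\<dots> = 1 + ?q\<^sup>2 + ?m"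
    using i_less by (simp add: sum.distrib)
  finally show ?thesis .
qed

lemma EYM_linear_ode:
  assumes n: "n \<ge> 2"
  shows "EYM n euclid_time euclid_space (linear_ode_system n coef rhs) t x
    = (1/4) * (real n - 1 + 2 * (coef 2 t / coef 0 t) + (\<Sum>j=2..n. (coef j t)\<^sup>2 / (coef 0 t)\<^sup>2))"
proof -
  have "EYM n euclid_time euclid_space (linear_ode_system n coef rhs) t x
      = (\<Sum>i=1..n-1. \<Sum>j=i+1..n. (1/4) * (ode_B n coef t i j)\<^sup>2)"
    unfolding EYM_def
    by (intro sum.cong refl)
      (simp add: em_component_linear_ode[OF n] ode_N_def power_divide)
  also have "\<dots> = (1/4) * (\<Sum>i=1..n-1. \<Sum>j=i+1..n. (ode_B n coef t i j)\<^sup>2)"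
    by (simp add: sum_distrib_left)
  also have "(\<Sum>i=1..n-1. \<Sum>j=i+1..n. (ode_B n coef t i j)\<^sup>2)
      = (\<Sum>i=1..n-1. 1 + (coef (n + 1 - i) t / coef 0 t)\<^sup>2
          + (if i = n - 1 then 2 * (coef 2 t / coef 0 t) else 0))"
    by (intro sum.cong refl ode_B_row_energy)
  also have "\<dots> = real n - 1 + (\<Sum>i=1..n-1. (coef (n + 1 - i) t / coef 0 t)\<^sup>2)
      + 2 * (coef 2 t / coef 0 t)"
    using n by (simp add: sum.distrib of_nat_diff)
  also have "(\<Sum>i=1..n-1. (coef (n + 1 - i) t / coef 0 t)\<^sup>2)
      = (\<Sum>j=2..n. (coef j t)\<^sup>2 / (coef 0 t)\<^sup>2)"
    by (rule sum.reindex_bij_witness[of _ "\<lambda>j. n + 1 - j" "\<lambda>i. n + 1 - i"])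
      (use n in \<open>auto simp: power_divide\<close>)
  finally show ?thesis
    by (simp add: algebra_simps)
qed

section \<open>Equivalence of the equation and its system\<close>

text \<open>
  The last component of the system is the equation of order \<open>n\<close> solved for its highest derivative
  \<open>u n\<close>, where \<open>u k\<close> stands for the value of the \<open>k\<close>-th derivative.
\<close>

lemma linear_ode_highest_derivative:
  assumes "n \<ge> 1" and nz: "coef 0 t \<noteq> 0"
  shows "(\<Sum>k=0..n. coef k t * u (n - k)) = rhs t
    \<longleftrightarrow> u n = linear_ode_system n coef rhs t (\<lambda>i. u (i - 1)) n"
proof -
  have "(\<Sum>k=0..n. coef k t * u (n - k)) = coef 0 t * u n + (\<Sum>k=1..n. coef k t * u (n - k))"
    by (simp add: sum.atLeast_Suc_atMost)
  also have "(\<Sum>k=1..n. coef k t * u (n - k)) = (\<Sum>k=1..n. coef (n + 1 - k) t * u (k - 1))"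
    by (rule sum.reindex_bij_witness[of _ "\<lambda>k. n + 1 - k" "\<lambda>k. n + 1 - k"]) auto
  also have "\<dots> = coef 0 t * (\<Sum>k=1..n. coef (n + 1 - k) t / coef 0 t * u (k - 1))"
    using nz by (simp add: sum_distrib_left)
  finally show ?thesis
    using nz by (auto simp: linear_ode_system_def field_simps)
qed

lemma solves_linear_ode_iff_system:
  assumes n: "n \<ge> 1" and ab: "a < b"
    and nz: "\<And>t. t \<in> {a..b} \<Longrightarrow> coef 0 t \<noteq> 0"
  shows "solves_linear_ode n {a..b} coef rhs y
    \<longleftrightarrow> solves_system n {a..b} (linear_ode_system n coef rhs)
          (\<lambda>t i. nth_time_deriv {a..b} (i - 1) y t)"
    (is "?ode \<longleftrightarrow> ?sys")
proof
  let ?u = "\<lambda>t k. nth_time_deriv {a..b} k y t"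
  assume ode: ?ode
  show ?sys
    unfolding solves_system_def
  proof (intro ballI)
    fix t i assume t: "t \<in> {a..b}" and i: "i \<in> {1..n}"
    have "nth_time_deriv {a..b} (i - 1) y differentiable (at t within {a..b})"
      using ode t i unfolding solves_linear_ode_def by auto
    then have "(nth_time_deriv {a..b} (i - 1) y has_vector_derivative ?u t (Suc (i - 1)))
        (at t within {a..b})"
      by (simp add: has_vector_derivative_time_deriv nth_time_deriv_Suc)
    moreover have "?u t (Suc (i - 1)) = linear_ode_system n coef rhs t (\<lambda>i. ?u t (i - 1)) i"
    proof (cases "i = n")
      case True
      have "(\<Sum>k=0..n. coef k t * ?u t (n - k)) = rhs t"
        using ode t unfolding solves_linear_ode_def by blast
      then have "?u t n = linear_ode_system n coef rhs t (\<lambda>i. ?u t (i - 1)) n"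
        using linear_ode_highest_derivative[of n coef t "?u t" rhs, OF n nz[OF t]] by blast
      then show ?thesis using True n by simp
    next
      case False
      then show ?thesis using i by (simp add: linear_ode_system_def)
    qed
    ultimately show "((\<lambda>s. ?u s (i - 1)) has_vector_derivative
        linear_ode_system n coef rhs t (\<lambda>i. ?u t (i - 1)) i) (at t within {a..b})"
      by simp
  qed
next
  let ?u = "\<lambda>t k. nth_time_deriv {a..b} k y t"
  assume sys: ?sys
  have deriv: "(nth_time_deriv {a..b} k y has_vector_derivative
      linear_ode_system n coef rhs t (\<lambda>i. ?u t (i - 1)) (k + 1)) (at t within {a..b})"
    if "t \<in> {a..b}" "k < n" for t k
    using sys that unfolding solves_system_def by force
  show ?ode
    unfolding solves_linear_ode_def
  proof (intro conjI allI impI ballI)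
    fix k t assume "k < n" "t \<in> {a..b}"
    then show "nth_time_deriv {a..b} k y differentiable (at t within {a..b})"
      using deriv by (blast intro: differentiableI_vector)
  next
    fix t assume t: "t \<in> {a..b}"
    obtain m where m: "n = Suc m" using n by (cases n) auto
    have "?u t n = linear_ode_system n coef rhs t (\<lambda>i. ?u t (i - 1)) n"
      using time_deriv_eqI[OF ab t deriv[OF t, of m]] by (simp add: m nth_time_deriv_Suc)
    then show "(\<Sum>k=0..n. coef k t * ?u t (n - k)) = rhs t"
      using linear_ode_highest_derivative[of n coef t "?u t" rhs, OF n nz[OF t]] by blast
  qed
qed

text \<open>
  The induction needs the equality at all points of the interval at once, since it is
  differentiated in the step.
\<close>

lemma system_components_are_derivatives:
  assumes ab: "a < b"
    and sol: "solves_system n {a..b} (linear_ode_system n coef rhs) x"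
  shows "\<lbrakk>k < n; t \<in> {a..b}\<rbrakk> \<Longrightarrow> x t (k + 1) = nth_time_deriv {a..b} k (\<lambda>s. x s 1) t"
proof (induction k arbitrary: t)
  case (Suc k)
  have "((\<lambda>s. x s (k + 1)) has_vector_derivative x t (k + 2)) (at t within {a..b})"
    using sol[unfolded solves_system_def, rule_format, of t "k + 1"] Suc.prems
    by (simp add: linear_ode_system_def)
  then have "(nth_time_deriv {a..b} k (\<lambda>s. x s 1) has_vector_derivative x t (k + 2))
      (at t within {a..b})"
    by (rule has_vector_derivative_transform[rotated 2]) (use Suc in auto)
  then show ?case
    using time_deriv_eqI[OF ab Suc.prems(2)] by (simp add: nth_time_deriv_Suc)
qed simp

text \<open>
  A solution may be changed outside \<open>T\<close> and at indices outside \<open>{1..n}\<close>: derivatives within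
  \<open>T\<close> do not see the former, and a right-hand side that is a function on \<open>R^n\<close> does not see the
  latter. This lets a solution be replaced by the sequence of derivatives of its first component.
\<close>

lemma solves_system_cong:
  assumes "\<And>t i. t \<in> T \<Longrightarrow> i \<in> {1..n} \<Longrightarrow> x t i = z t i"
    and "\<And>t u w i. (\<And>j. j \<in> {1..n} \<Longrightarrow> u j = w j) \<Longrightarrow> i \<in> {1..n} \<Longrightarrow> X t u i = X t w i"
    and sol: "solves_system n T X x"
  shows "solves_system n T X z"
  unfolding solves_system_def
proof (intro ballI)
  fix t i assume t: "t \<in> T" and i: "i \<in> {1..n}"
  have "((\<lambda>s. x s i) has_vector_derivative X t (x t) i) (at t within T)"
    using sol t i unfolding solves_system_def by blast
  moreover have "X t (x t) i = X t (z t) i"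
    by (rule assms(2)) (use assms(1) t i in auto)
  ultimately show "((\<lambda>s. z s i) has_vector_derivative X t (z t) i) (at t within T)"
    using has_vector_derivative_transform[of t T "\<lambda>s. z s i" "\<lambda>s. x s i"] assms(1) t i by auto
qed

lemma solves_system_imp_linear_ode:
  assumes n: "n \<ge> 1" and ab: "a < b"
    and nz: "\<And>t. t \<in> {a..b} \<Longrightarrow> coef 0 t \<noteq> 0"
    and sol: "solves_system n {a..b} (linear_ode_system n coef rhs) x"
  shows "solves_linear_ode n {a..b} coef rhs (\<lambda>t. x t 1)"
    and "\<And>t i. t \<in> {a..b} \<Longrightarrow> i \<in> {1..n}
      \<Longrightarrow> x t i = nth_time_deriv {a..b} (i - 1) (\<lambda>s. x s 1) t"
proof -
  show eq: "x t i = nth_time_deriv {a..b} (i - 1) (\<lambda>s. x s 1) t"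
    if "t \<in> {a..b}" "i \<in> {1..n}" for t i
    using system_components_are_derivatives[OF ab sol, of "i - 1" t] that by (cases i) auto
  have "linear_ode_system n coef rhs t u i = linear_ode_system n coef rhs t w i"
    if "\<And>j. j \<in> {1..n} \<Longrightarrow> u j = w j" "i \<in> {1..n}" for t u w i
    using that by (auto simp: linear_ode_system_def intro!: sum.cong)
  then have "solves_system n {a..b} (linear_ode_system n coef rhs)
      (\<lambda>t i. nth_time_deriv {a..b} (i - 1) (\<lambda>s. x s 1) t)"
    using solves_system_cong[OF eq _ sol] by blast
  then show "solves_linear_ode n {a..b} coef rhs (\<lambda>t. x t 1)"
    using solves_linear_ode_iff_system[where coef = coef, OF n ab nz] by blast
qed

section \<open>The geometrical objects produced by a linear equation\<close>

theorem corollary5p1: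
  fixes n :: nat and a b :: real
    and coef :: "nat \<Rightarrow> real \<Rightarrow> real" and rhs :: "real \<Rightarrow> real"
    and T :: "real set" and X :: ode_system
  assumes n: "n \<ge> 2"
    and T: "a < b" "T = {a..b}"
    and smooth: "\<And>k. k \<le> n \<Longrightarrow> smooth_fun_on T (coef k)" "smooth_fun_on T rhs"
    and nonzero: "\<And>t. t \<in> T \<Longrightarrow> coef 0 t \<noteq> 0"
    and X: "X = linear_ode_system n coef rhs"
  shows
    "(\<forall>y. solves_linear_ode n T coef rhs y
         \<longleftrightarrow> solves_system n T X (\<lambda>t i. nth_time_deriv T (i - 1) y t)) \<and>
     (\<forall>x. solves_system n T X x \<longrightarrow>
         solves_linear_ode n T coef rhs (\<lambda>t. x t 1) \<and>
         (\<forall>t\<in>T. \<forall>i\<in>{1..n}. x t i = nth_time_deriv T (i - 1) (\<lambda>s. x s 1) t)) \<and>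
     (\<forall>t\<in>T. \<forall>x v.
        \<comment> \<open>(i)\<close>
        (\<forall>i\<in>{1..n}. nlc_M T euclid_time t v i = 0) \<and>
        (\<forall>i\<in>{1..n}. \<forall>j\<in>{1..n}.
           nlc_N n euclid_space X t x v i j = ode_N n coef t i j \<and>
           ode_N n coef t i j = - ode_N n coef t j i) \<and>
        \<comment> \<open>(ii)\<close>
        (let C = cartan_connection n T euclid_time euclid_space t x in
           conn_H C = 0 \<and>
           (\<forall>i\<in>{1..n}. \<forall>j\<in>{1..n}. conn_G C i j = 0) \<and>
           (\<forall>i\<in>{1..n}. \<forall>j\<in>{1..n}. \<forall>k\<in>{1..n}. conn_L C i j k = 0 \<and> conn_C C i j k = 0)) \<and>
        \<comment> \<open>(iii)\<close>
        (let R = torsion n T euclid_time euclid_space X t x v in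
           (\<forall>i\<in>{1..n-1}.
              R (Fibre i) (TimeSpace n) =
                (time_deriv T (coef (n - i + 1)) t * coef 0 t
                  - coef (n - i + 1) t * time_deriv T (coef 0) t) / (2 * (coef 0 t)\<^sup>2) \<and>
              R (Fibre i) (TimeSpace n) = - R (Fibre n) (TimeSpace i)) \<and>
           (\<forall>A P. index_in_range n A \<and> pair_in_range n P \<and>
              \<not> (\<exists>i\<in>{1..n-1}. (A = Fibre i \<and> P = TimeSpace n) \<or> (A = Fibre n \<and> P = TimeSpace i))
              \<longrightarrow> R A P = 0)) \<and>
        \<comment> \<open>(iv)\<close>
        (\<forall>A B P. index_in_range n A \<and> index_in_range n B \<and> pair_in_range n P
           \<longrightarrow> curvature n euclid_space x A B P = 0) \<and>
        \<comment> \<open>(v)\<close>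
        (\<forall>i\<in>{1..n}. \<forall>w. delta_x1 n T euclid_time euclid_space X t x v i w =
           form_dx1 i w + (\<Sum>k=1..n. ode_N n coef t i k * form_dx k w)) \<and>
        (\<forall>i\<in>{1..n}. \<forall>j\<in>{1..n}.
           em_component n euclid_time euclid_space X t x i j = - ode_N n coef t i j) \<and>
        (\<forall>w w'. em_form n T euclid_time euclid_space X t x v w w' =
           (\<Sum>i=1..n. \<Sum>j=1..n. (- ode_N n coef t i j) *
              wedge (\<lambda>u. form_dx1 i u + (\<Sum>k=1..n. ode_N n coef t i k * form_dx k u))
                (form_dx j) w w')) \<and>
        \<comment> \<open>(vi)\<close>
        EYM n euclid_time euclid_space X t x =
          (1/4) * (real n - 1 + 2 * (coef 2 t / coef 0 t)
                   + (\<Sum>j=2..n. (coef j t)\<^sup>2 / (coef 0 t)\<^sup>2)))"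
proof -
  let ?S = "linear_ode_system n coef rhs"
  let ?R = "torsion n {a..b} euclid_time euclid_space ?S"
  have n1: "n \<ge> 1" using n by simp
  have nz: "\<And>t. t \<in> {a..b} \<Longrightarrow> coef 0 t \<noteq> 0" using nonzero T by simp
  have diff: "coef k differentiable (at t within {a..b})" if "k \<le> n" "t \<in> {a..b}" for k t
    using smooth_fun_on_differentiable smooth(1) that T by blast
  have delta: "delta_x1 n {a..b} euclid_time euclid_space ?S t x v i w
      = form_dx1 i w + (\<Sum>k=1..n. ode_N n coef t i k * form_dx k w)"
    if "t \<in> {a..b}" "i \<in> {1..n}" for t x v i w
    using that
    by (simp add: delta_x1_def nlc_M_def time_christoffel_euclid[OF T(1)] nlc_N_linear_ode[OF n])
  have em_form: "em_form n {a..b} euclid_time euclid_space ?S t x v w w'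
      = (\<Sum>i=1..n. \<Sum>j=1..n. (- ode_N n coef t i j) *
          wedge (\<lambda>u. form_dx1 i u + (\<Sum>k=1..n. ode_N n coef t i k * form_dx k u)) (form_dx j) w w')"
    if "t \<in> {a..b}" for t x v w w'
    unfolding em_form_def
    by (intro sum.cong refl) (simp add: em_component_linear_ode[OF n] wedge_def delta[OF that])
  have torsion_last: "?R t x v (Fibre i) (TimeSpace n)
      = (time_deriv {a..b} (coef (n - i + 1)) t * coef 0 t
          - coef (n - i + 1) t * time_deriv {a..b} (coef 0) t) / (2 * (coef 0 t)\<^sup>2)"
    if t: "t \<in> {a..b}" and i: "i \<in> {1..n-1}" for t x v i
  proof -
    have "n - i + 1 \<le> n" using i by auto
    then have "coef (n - i + 1) differentiable (at t within {a..b})" using diff t by blast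
    moreover have "coef 0 differentiable (at t within {a..b})" using diff t by blast
    ultimately show ?thesis
      unfolding torsion.simps
      by (intro torsion_temporal_linear_ode_last_column T(1) t i nz)
  qed
  have torsion_skew: "?R t x v (Fibre i) (TimeSpace n) = - ?R t x v (Fibre n) (TimeSpace i)"
    if t: "t \<in> {a..b}" and i: "i \<in> {1..n-1}" for t x v i
    unfolding torsion.simps by (intro torsion_temporal_linear_ode_skew T(1) t) (use i in auto)
  show ?thesis
    unfolding X T(2) Let_def
    by (intro conjI allI ballI impI solves_linear_ode_iff_system[where coef = coef, OF n1 T(1) nz]
        solves_system_imp_linear_ode[where coef = coef, OF n1 T(1) nz] torsion_skew ode_N_skew)
      (simp_all add: nlc_M_def time_christoffel_euclid[OF T(1)] nlc_N_linear_ode[OF n]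
        cartan_connection_def christoffel_euclid curvature_euclid delta em_form
        torsion_last torsion_linear_ode_zero[OF T(1)]
        em_component_linear_ode[OF n] EYM_linear_ode[OF n]
        del: One_nat_def torsion.simps)
qed

end
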